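(* Let $\mathcal{X},\mathcal{V},\mathcal{W}$ be real Hilbert spaces, let $\mathcal{L}:\mathcal{X}\to\mathcal{V}$ and $\mathcal{B}:\mathcal{X}\to\mathcal{W}$ be linear operators, and let $\delta\geqslant 1$. Suppose there exist constants $C_1,C_2>0$ such that $\|\mathcal{L}[\mathbf{v}]\|_{\mathcal{V}}\leqslant C_1\|\mathbf{v}\|_{\mathcal{X}}$ and $\|\mathcal{B}[\mathbf{v}]\|_{\mathcal{W}}\leqslant C_2\|\mathbf{v}\|_{\mathcal{X}}$ for all $\mathbf{v}\in\mathcal{X}$. Suppose also that there is a constant $C_3>0$ such that, for all $\mathbf{f}\in\mathcal{V}$ and $\mathbf{g}\in\mathcal{W}$, the problem $\mathcal{L}[\mathbf{u}]=\mathbf{f}$, $\mathcal{B}[\mathbf{u}]=\mathbf{g}$ admits a unique solution $\mathbf{u}\in\mathcal{X}$ and this solution satisfies $$\|\mathbf{u}\|_{\mathcal{X}}\leqslant C_3\left(\|\mathbf{f}\|_{\mathcal{V}}+\|\mathbf{g}\|_{\mathcal{W}}\right).$$ Given $\mathbf{f}\in\mathcal{V}$ and $\mathbf{g}\in\mathcal{W}$, define $$a_{LS}(\mathbf{u},\mathbf{v})=(\mathcal{L}[\mathbf{u}],\mathcal{L}[\mathbf{v}])_{\mathcal{V}}+\delta(\mathcal{B}[\mathbf{u}],\mathcal{B}[\mathbf{v}])_{\mathcal{W}},\qquad F_{LS}(\mathbf{v})=(\mathbf{f},\mathcal{L}[\mathbf{v}])_{\mathcal{V}}+\delta(\mathbf{g},\mathcal{B}[\mathbf{v}])_{\mathcal{W}}.$$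 Then the bilinear form $a_{LS}$ is continuous and coercive and the linear form $F_{LS}$ is continuous, in the sense that there exist constants $\mathcal{C}_1,\mathcal{C}_2,\mathcal{C}_3>0$ such that $$a_{LS}(\mathbf{u},\mathbf{v})\leqslant\mathcal{C}_1\|\mathbf{u}\|_{\mathcal{X}}\|\mathbf{v}\|_{\mathcal{X}},\qquad \mathcal{C}_2\|\mathbf{v}\|_{\mathcal{X}}^2\leqslant a_{LS}(\mathbf{v},\mathbf{v}),\qquad F_{LS}(\mathbf{v})\leqslant\mathcal{C}_3\|\mathbf{v}\|_{\mathcal{X}}$$ for all $\mathbf{u},\mathbf{v}\in\mathcal{X}$. Consequently, there is a unique $\mathbf{u}\in\mathcal{X}$ such that $a_{LS}(\mathbf{u},\mathbf{v})=F_{LS}(\mathbf{v})$ for all $\mathbf{v}\in\mathcal{X}$.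
   Context: In the source, $\mathcal{L}$ is a linear differential operator on a domain $\Omega$ and $\mathcal{B}$ is a linear boundary operator on $\partial\Omega$, and the pair of equations is the boundary value problem $\mathcal{L}[\mathbf{u}]=\mathbf{f}$ in $\Omega$, $\mathcal{B}[\mathbf{u}]=\mathbf{g}$ on $\partial\Omega$. Only the abstract Hilbert space structure is used in the statement. The constant $\mathcal{C}_3$ may depend on $\mathbf{f},\mathbf{g}$. *)

theory Defs
  imports "HOL-Analysis.Analysis"
begin

text \<open>Real Hilbert spaces are types of sort \<open>{real_inner, complete_space}\<close>.\<close>

definition a_LS ::
  "('x::real_vector \<Rightarrow> 'v::real_inner) \<Rightarrow> ('x \<Rightarrow> 'w::real_inner) \<Rightarrow> real \<Rightarrow> 'x \<Rightarrow> 'x \<Rightarrow> real"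
  where "a_LS L B \<delta> u v = L u \<bullet> L v + \<delta> * (B u \<bullet> B v)"

definition F_LS ::
  "('x::real_vector \<Rightarrow> 'v::real_inner) \<Rightarrow> ('x \<Rightarrow> 'w::real_inner) \<Rightarrow> real \<Rightarrow> 'v \<Rightarrow> 'w \<Rightarrow> 'x \<Rightarrow> real"
  where "F_LS L B \<delta> f g v = f \<bullet> L v + \<delta> * (g \<bullet> B v)"

end

theory Submission
  imports Defs
begin

text \<open>Coercivity comes from the stability estimate applied with \<open>f = L v\<close> and \<open>g = B v\<close>.
  Since \<open>(L, B)\<close> is onto, Lax--Milgram is not needed: the solution of \<open>L u = f\<close>, \<open>B u = g\<close>
  solves the variational problem, and coercivity makes that solution unique.\<close>

lemma linear_F_LS:
  assumes "linear L" "linear B"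
  shows "linear (F_LS L B \<delta> f g)"
  by (rule linearI)
    (simp_all add: F_LS_def linear_add[OF assms(1)] linear_add[OF assms(2)]
      linear_scale[OF assms(1)] linear_scale[OF assms(2)] algebra_simps)

text \<open>Reduces linearity and boundedness of the form to those of the functional. It also shows
  at once that a solution of \<open>L u = f\<close>, \<open>B u = g\<close> solves the variational
  problem.\<close>

lemma a_LS_eq_F_LS: "a_LS L B \<delta> u = F_LS L B \<delta> (L u) (B u)"
  by (simp add: a_LS_def F_LS_def fun_eq_iff)

lemma a_LS_commute: "a_LS L B \<delta> u v = a_LS L B \<delta> v u"
  by (simp add: a_LS_def inner_commute)

lemma bilinear_a_LS:
  assumes "linear L" "linear B"
  shows "bilinear (a_LS L B \<delta>)"
proof -
  have "linear (a_LS L B \<delta> u)" for u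
    unfolding a_LS_eq_F_LS by (rule linear_F_LS[OF assms])
  \<comment> \<open>Symmetry carries linearity over from the second argument to the first.\<close>
  moreover have "(\<lambda>u. a_LS L B \<delta> u v) = a_LS L B \<delta> v" for v
    using a_LS_commute by (rule ext)
  ultimately show ?thesis
    by (simp add: bilinear_def)
qed

text \<open>Cauchy-Schwarz in each target space. The constant is kept explicit in
  \<open>norm f\<close> and \<open>norm g\<close> so that \<open>f = L u\<close>,
  \<open>g = B u\<close> can be inserted to bound \<open>a_LS\<close>.\<close>

lemma F_LS_le:
  assumes "\<delta> \<ge> 0" and L: "\<And>v. norm (L v) \<le> C1 * norm v" and B: "\<And>v. norm (B v) \<le> C2 * norm v"
  shows "F_LS L B \<delta> f g v \<le> (norm f * C1 + \<delta> * (norm g * C2)) * norm v"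
proof -
  have "f \<bullet> L v \<le> norm f * (C1 * norm v)"
    by (rule order_trans[OF norm_cauchy_schwarz mult_left_mono[OF L norm_ge_zero]])
  moreover have "g \<bullet> B v \<le> norm g * (C2 * norm v)"
    by (rule order_trans[OF norm_cauchy_schwarz mult_left_mono[OF B norm_ge_zero]])
  then have "\<delta> * (g \<bullet> B v) \<le> \<delta> * (norm g * (C2 * norm v))"
    using \<open>\<delta> \<ge> 0\<close> by (rule mult_left_mono)
  ultimately show ?thesis
    by (simp add: F_LS_def algebra_simps)
qed

lemma a_LS_le:
  assumes "\<delta> \<ge> 0" and "C1 \<ge> 0" and "C2 \<ge> 0"
    and L: "\<And>v. norm (L v) \<le> C1 * norm v" and B: "\<And>v. norm (B v) \<le> C2 * norm v"
  shows "a_LS L B \<delta> u v \<le> (C1\<^sup>2 + \<delta> * C2\<^sup>2) * norm u * norm v"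
proof -
  have "a_LS L B \<delta> u v \<le> (norm (L u) * C1 + \<delta> * (norm (B u) * C2)) * norm v"
    unfolding a_LS_eq_F_LS by (rule F_LS_le[OF \<open>\<delta> \<ge> 0\<close> L B])
  \<comment> \<open>The bounds on \<open>L\<close> and \<open>B\<close> enter a second time, now for
    \<open>u\<close>; hence the squares of \<open>C1\<close> and \<open>C2\<close>.\<close>
  also have "\<dots> \<le> (C1 * norm u * C1 + \<delta> * (C2 * norm u * C2)) * norm v"
    using assms by (intro mult_right_mono add_mono mult_left_mono) auto
  finally show ?thesis
    by (simp add: power2_eq_square algebra_simps)
qed

lemma a_LS_coercive:
  assumes "\<delta> \<ge> 1" and "C > 0" and stab: "norm v \<le> C * (norm (L v) + norm (B v))"
  shows "1 / (2 * C\<^sup>2) * (norm v)\<^sup>2 \<le> a_LS L B \<delta> v v"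
proof -
  \<comment> \<open>The stability bound has a sum of norms, the form a sum of squares; passing
    between them costs the factor 2 in the constant.\<close>
  have "(norm (L v) + norm (B v))\<^sup>2 \<le> 2 * ((norm (L v))\<^sup>2 + (norm (B v))\<^sup>2)"
    using zero_le_power2[of "norm (L v) - norm (B v)"]
    by (simp add: power2_diff power2_sum)
  \<comment> \<open>As \<open>\<delta> \<ge> 1\<close>, weighting the boundary term by
    \<open>\<delta>\<close> can only increase it.\<close>
  also have "\<dots> \<le> 2 * a_LS L B \<delta> v v"
    using mult_right_mono[OF \<open>\<delta> \<ge> 1\<close> zero_le_power2[of "norm (B v)"]]
    by (simp add: a_LS_def power2_norm_eq_inner)
  finally have "C\<^sup>2 * (norm (L v) + norm (B v))\<^sup>2 \<le> C\<^sup>2 * (2 * a_LS L B \<delta> v v)"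
    by (rule mult_left_mono) simp
  moreover have "(norm v)\<^sup>2 \<le> C\<^sup>2 * (norm (L v) + norm (B v))\<^sup>2"
    using power_mono[OF stab norm_ge_zero, of 2] by (simp add: power_mult_distrib)
  ultimately have "(norm v)\<^sup>2 \<le> C\<^sup>2 * (2 * a_LS L B \<delta> v v)"
    by linarith
  then show ?thesis
    using \<open>C > 0\<close> by (simp add: field_simps)
qed

text \<open>By linearity in the first argument the values of \<open>F\<close> cancel for
  \<open>x - y\<close>; testing with \<open>x - y\<close> itself, coercivity forces its norm to
  vanish.\<close>

lemma variational_solution_unique:
  assumes bil: "bilinear a" and "c > 0" and coer: "\<And>v. c * (norm v)\<^sup>2 \<le> a v v"
    and "\<And>v. a x v = F v" and "\<And>v. a y v = F v"
  shows "x = y"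
proof -
  have "a (x - y) (x - y) = 0"
    using assms(4,5) by (simp add: bilinear_lsub[OF bil])
  then have "c * (norm (x - y))\<^sup>2 \<le> 0"
    using coer[of "x - y"] by simp
  then show ?thesis
    using \<open>c > 0\<close> by (simp add: mult_le_0_iff)
qed

theorem theorem2p1:
  fixes L :: "'x::{real_inner, complete_space} \<Rightarrow> 'v::{real_inner, complete_space}"
    and B :: "'x \<Rightarrow> 'w::{real_inner, complete_space}"
    and \<delta> :: real
  assumes "linear L" and "linear B" and "\<delta> \<ge> 1"
    and "\<exists>C1>0. \<forall>v. norm (L v) \<le> C1 * norm v"
    and "\<exists>C2>0. \<forall>v. norm (B v) \<le> C2 * norm v"
    and "\<exists>C3>0. \<forall>f g. (\<exists>!u. L u = f \<and> B u = g) \<and>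
           (\<forall>u. L u = f \<and> B u = g \<longrightarrow> norm u \<le> C3 * (norm f + norm g))"
  shows "bilinear (a_LS L B \<delta>) \<and>
    (\<exists>C1>0. \<forall>u v. a_LS L B \<delta> u v \<le> C1 * norm u * norm v) \<and>
    (\<exists>C2>0. \<forall>v. C2 * (norm v)\<^sup>2 \<le> a_LS L B \<delta> v v) \<and>
    (\<forall>f g. linear (F_LS L B \<delta> f g) \<and>
       (\<exists>C3>0. \<forall>v. F_LS L B \<delta> f g v \<le> C3 * norm v) \<and>
       (\<exists>!u. \<forall>v. a_LS L B \<delta> u v = F_LS L B \<delta> f g v))"
proof -
  obtain C1 where C1: "C1 > 0" "\<And>v. norm (L v) \<le> C1 * norm v"
    using assms(4) by blast
  obtain C2 where C2: "C2 > 0" "\<And>v. norm (B v) \<le> C2 * norm v"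
    using assms(5) by blast
  obtain C3 where C3_pos: "C3 > 0" and wellposed: "\<forall>f g. (\<exists>!u. L u = f \<and> B u = g) \<and>
      (\<forall>u. L u = f \<and> B u = g \<longrightarrow> norm u \<le> C3 * (norm f + norm g))"
    using assms(6) by (elim exE conjE)
  \<comment> \<open>Every \<open>v\<close> is a solution for its own data, so the a priori bound
    holds on the whole space.\<close>
  have stab: "norm v \<le> C3 * (norm (L v) + norm (B v))" for v
    using wellposed by simp
  have ex: "\<exists>u. L u = f \<and> B u = g" for f g
    using wellposed by (simp add: ex1_implies_ex)
  have bil: "bilinear (a_LS L B \<delta>)"
    using assms(1,2) by (rule bilinear_a_LS)
  have cont: "\<exists>C>0. \<forall>u v. a_LS L B \<delta> u v \<le> C * norm u * norm v"
  proof (intro exI conjI allI)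
    show "C1\<^sup>2 + \<delta> * C2\<^sup>2 > 0"
      using C1(1) \<open>\<delta> \<ge> 1\<close> by (intro add_pos_nonneg) auto
    show "a_LS L B \<delta> u v \<le> (C1\<^sup>2 + \<delta> * C2\<^sup>2) * norm u * norm v" for u v
      using C1 C2 \<open>\<delta> \<ge> 1\<close> by (intro a_LS_le) auto
  qed
  define c where "c = 1 / (2 * C3\<^sup>2)"
  have c_pos: "c > 0"
    using C3_pos by (simp add: c_def)
  have coer: "c * (norm v)\<^sup>2 \<le> a_LS L B \<delta> v v" for v
    unfolding c_def using assms(3) C3_pos stab by (rule a_LS_coercive)
  have F_cont: "\<exists>C>0. \<forall>v. F_LS L B \<delta> f g v \<le> C * norm v" for f g
  proof (intro exI conjI allI)
    let ?K = "norm f * C1 + \<delta> * (norm g * C2)"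
    \<comment> \<open>The summand 1 keeps the constant positive when \<open>f = 0\<close> and \<open>g = 0\<close>.\<close>
    show "?K + 1 > 0"
      using C1(1) C2(1) \<open>\<delta> \<ge> 1\<close> by (intro add_nonneg_pos add_nonneg_nonneg) auto
    show "F_LS L B \<delta> f g v \<le> (?K + 1) * norm v" for v
      using F_LS_le[of \<delta> L C1 B C2 f g v] C1(2) C2(2) \<open>\<delta> \<ge> 1\<close>
      by (simp add: distrib_right add_increasing2)
  qed
  have "\<exists>!u. \<forall>v. a_LS L B \<delta> u v = F_LS L B \<delta> f g v" for f g
  proof -
    obtain u where "L u = f" "B u = g"
      using ex by blast
    \<comment> \<open>With \<open>L u = f\<close> and \<open>B u = g\<close>, the two functionals of
      \<open>v\<close> coincide.\<close>
    then have "\<forall>v. a_LS L B \<delta> u v = F_LS L B \<delta> f g v"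
      by (simp add: a_LS_eq_F_LS)
    then show ?thesis
      using variational_solution_unique[OF bil c_pos coer] by blast
  qed
  then show ?thesis
    using bil cont c_pos coer F_cont linear_F_LS[OF assms(1,2)] by (intro conjI allI) blast+
qed

end
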